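(* If the Bayesian predictor $p_0$ is unique and the statistic $S=S(X)$ is $Y$-sufficient, then $$p_0(X)=\mathbb{E}\big(Y\mid S(X)\big).$$
   Context: $(X,Y)$ is a random vector with values in $(F\times G,\mathcal{F}\otimes\mathcal{G})$, with $Y$ real valued. Its distribution belongs to a family $(\mathbb{P}_\theta,\theta\in\Theta)$, where $\Theta\subset\mathbb{R}$ is open and $\mathbb{P}_\theta$ has density $f(x,y,\theta)$ with respect to a $\sigma$-finite measure $\lambda\otimes\mu$. A random variable $\mathbb{T}$ with values in $\Theta$ has prior distribution $\tau$, with density $\varphi(\theta)$ with respect to a $\sigma$-finite measure $\nu$. The joint law of $(X,Y,\mathbb{T})$ is $\mathbb{Q}$, with density $f(x,y,\theta)\varphi(\theta)$ with respect to $\lambda\otimes\mu\otimes\nu$. $\mathbb{E}$ and $\mathbb{E}(\cdot\mid\cdot)$ denote expectation and conditional expectation under $\mathbb{Q}$; equalities between conditional expectations are almost sure. $Y$ and the predictors are taken square integrable. The Bayesian predictor is $p_0(X)=\arg\min_p\mathbb{E}(p(X)-Y)^2=\mathbb{E}(Y\mid X)$, the minimum being over real measurable functions $p(X)$ of $X$; it is assumed to exist. It is called unique if it differs from any other Bayesian predictor only on a set $\mathcal{N}$ with $\mathbb{P}_\theta(\mathcal{N})=0$ for all $\theta\in\Theta$. A statistic $S=S(X)$ is $Y$-sufficient (sufficient for predicting $Y$) if (a) $S$ is sufficient in the statistical model associated with $X$, i.e. there exists a version of the conditional distribution of $X$ given $S$ that does not depend on $\theta$; and (b) $X$ and $Y$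 are conditionally independent given $S$ (under $\mathbb{P}_\theta$, for every $\theta\in\Theta$). *)

theory Defs
  imports "HOL-Probability.Probability"
begin

text \<open>Everything lives on the canonical space: $(X,Y)$ is the identity of $F \times G$ under
  $P_\theta$, and $(X,Y,T)$ the identity of $(F \times G) \times \Theta$ under $Q$. The measurable
  spaces $F$, $G$ and $\Theta$ are carried by the dominating measures \<open>lam\<close>, \<open>mu\<close> and \<open>nu\<close>.\<close>

definition model :: "'x measure \<Rightarrow> real measure \<Rightarrow> ('x \<Rightarrow> real \<Rightarrow> real \<Rightarrow> real) \<Rightarrow> real
    \<Rightarrow> ('x \<times> real) measure" where
  "model lam mu f \<theta> = density (lam \<Otimes>\<^sub>M mu) (\<lambda>(x, y). ennreal (f x y \<theta>))"

definition joint_law :: "'x measure \<Rightarrow> real measure \<Rightarrow> real measure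
    \<Rightarrow> ('x \<Rightarrow> real \<Rightarrow> real \<Rightarrow> real) \<Rightarrow> (real \<Rightarrow> real) \<Rightarrow> (('x \<times> real) \<times> real) measure" where
  "joint_law lam mu nu f \<phi> =
     density ((lam \<Otimes>\<^sub>M mu) \<Otimes>\<^sub>M nu) (\<lambda>((x, y), \<theta>). ennreal (f x y \<theta> * \<phi> \<theta>))"

definition X_of :: "('x \<times> real) \<times> real \<Rightarrow> 'x" where
  "X_of = (\<lambda>((x, y), \<theta>). x)"

definition Y_of :: "('x \<times> real) \<times> real \<Rightarrow> real" where
  "Y_of = (\<lambda>((x, y), \<theta>). y)"

text \<open>$E_M(W \mid Z)$ for \<open>Z\<close> with values in the measurable space \<open>N\<close>, as a function on the
  space of \<open>M\<close>.\<close>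

definition cond_exp_given ::
  "'w measure \<Rightarrow> 's measure \<Rightarrow> ('w \<Rightarrow> 's) \<Rightarrow> ('w \<Rightarrow> real) \<Rightarrow> 'w \<Rightarrow> real" where
  "cond_exp_given M N Z W = real_cond_exp M (vimage_algebra (space M) Z N) W"

definition bayes_model :: "'x measure \<Rightarrow> real measure \<Rightarrow> real measure \<Rightarrow> real set
    \<Rightarrow> ('x \<Rightarrow> real \<Rightarrow> real \<Rightarrow> real) \<Rightarrow> (real \<Rightarrow> real) \<Rightarrow> bool" where
  "bayes_model lam mu nu \<Theta> f \<phi> \<longleftrightarrow>
     sigma_finite_measure lam \<and> sigma_finite_measure mu \<and> sigma_finite_measure nu \<and>
     \<comment> \<open>\<open>G\<close> is any measurable space of reals whose inclusion into the line is Borel\<close>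
     (\<lambda>y. y) \<in> borel_measurable mu \<and>
     open \<Theta> \<and> sets nu = sets (restrict_space borel \<Theta>) \<and>
     (\<lambda>((x, y), \<theta>). f x y \<theta>) \<in> borel_measurable ((lam \<Otimes>\<^sub>M mu) \<Otimes>\<^sub>M nu) \<and>
     (\<forall>x\<in>space lam. \<forall>y\<in>space mu. \<forall>\<theta>\<in>\<Theta>. 0 \<le> f x y \<theta>) \<and>
     (\<forall>\<theta>\<in>\<Theta>. prob_space (model lam mu f \<theta>)) \<and>
     \<phi> \<in> borel_measurable nu \<and> (\<forall>\<theta>\<in>\<Theta>. 0 \<le> \<phi> \<theta>) \<and>
     prob_space (density nu (\<lambda>\<theta>. ennreal (\<phi> \<theta>)))"

definition predictors :: "'x measure \<Rightarrow> (('x \<times> real) \<times> real) measure \<Rightarrow> ('x \<Rightarrow> real) set" where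
  "predictors lam Q = {p \<in> borel_measurable lam. integrable Q (\<lambda>\<omega>. (p (X_of \<omega>))\<^sup>2)}"

definition bayesian_predictor ::
  "'x measure \<Rightarrow> (('x \<times> real) \<times> real) measure \<Rightarrow> ('x \<Rightarrow> real) \<Rightarrow> bool" where
  "bayesian_predictor lam Q p0 \<longleftrightarrow>
     is_arg_min (\<lambda>p. \<integral>\<omega>. (p (X_of \<omega>) - Y_of \<omega>)\<^sup>2 \<partial>Q) (\<lambda>p. p \<in> predictors lam Q) p0"

definition unique_bayesian_predictor :: "'x measure \<Rightarrow> (('x \<times> real) \<times> real) measure
    \<Rightarrow> real set \<Rightarrow> (real \<Rightarrow> ('x \<times> real) measure) \<Rightarrow> ('x \<Rightarrow> real) \<Rightarrow> bool" where
  "unique_bayesian_predictor lam Q \<Theta> P p0 \<longleftrightarrow>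
     bayesian_predictor lam Q p0 \<and>
     (\<forall>p. bayesian_predictor lam Q p \<longrightarrow> (\<forall>\<theta>\<in>\<Theta>. AE (x, y) in P \<theta>. p0 x = p x))"

text \<open>\<open>K\<close> is a regular version of the conditional distribution, given the statistic \<open>S\<close>, of a
  random element with law \<open>M\<close>.\<close>

definition cond_distribution ::
  "'x measure \<Rightarrow> 's measure \<Rightarrow> ('x \<Rightarrow> 's) \<Rightarrow> ('s \<Rightarrow> 'x measure) \<Rightarrow> bool" where
  "cond_distribution M N S K \<longleftrightarrow>
     K \<in> N \<rightarrow>\<^sub>M prob_algebra M \<and>
     (\<forall>A\<in>sets M. AE x in M. measure (K (S x)) A = cond_exp_given M N S (indicator A) x)"

text \<open>The law of \<open>X\<close> under \<open>P \<theta>\<close> is the first marginal \<open>distr (P \<theta>) lam fst\<close>. The kernel is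
  chosen before \<open>\<theta>\<close>.\<close>

definition sufficient_statistic :: "'x measure \<Rightarrow> 's measure \<Rightarrow> real set
    \<Rightarrow> (real \<Rightarrow> ('x \<times> real) measure) \<Rightarrow> ('x \<Rightarrow> 's) \<Rightarrow> bool" where
  "sufficient_statistic lam N \<Theta> P S \<longleftrightarrow>
     (\<exists>K. \<forall>\<theta>\<in>\<Theta>. cond_distribution (distr (P \<theta>) lam fst) N S K)"

definition cond_indep_given :: "'w measure \<Rightarrow> 's measure \<Rightarrow> ('w \<Rightarrow> 's)
    \<Rightarrow> 'a measure \<Rightarrow> ('w \<Rightarrow> 'a) \<Rightarrow> 'b measure \<Rightarrow> ('w \<Rightarrow> 'b) \<Rightarrow> bool" where
  "cond_indep_given M N Z MA U MB V \<longleftrightarrow>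
     (\<forall>A\<in>sets MA. \<forall>B\<in>sets MB. AE \<omega> in M.
        cond_exp_given M N Z (\<lambda>\<omega>. indicator A (U \<omega>) * indicator B (V \<omega>)) \<omega> =
        cond_exp_given M N Z (\<lambda>\<omega>. indicator A (U \<omega>)) \<omega> *
        cond_exp_given M N Z (\<lambda>\<omega>. indicator B (V \<omega>)) \<omega>)"

definition Y_sufficient :: "'x measure \<Rightarrow> real measure \<Rightarrow> 's measure \<Rightarrow> real set
    \<Rightarrow> (real \<Rightarrow> ('x \<times> real) measure) \<Rightarrow> ('x \<Rightarrow> 's) \<Rightarrow> bool" where
  "Y_sufficient lam mu N \<Theta> P S \<longleftrightarrow>
     S \<in> lam \<rightarrow>\<^sub>M N \<and>
     sufficient_statistic lam N \<Theta> P S \<and>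
     (\<forall>\<theta>\<in>\<Theta>. cond_indep_given (P \<theta>) N (\<lambda>(x, y). S x) lam fst mu snd)"

end

theory Submission
  imports Defs
begin

text \<open>The theorem rests on the identity $E(Y \mid X) = E(Y \mid S(X))$ under the joint law $Q$. The
  hypotheses give conditional independence of $X$ and $Y$ given $S$ only under each $P_\theta$, and
  mixing over $\theta$ does not preserve conditional independence in general. Sufficiency is what
  repairs this. If $K$ is the kernel of $X$ given $S$, common to all $\theta$, then conditional
  independence under $P_\theta$ reads
  \[ P_\theta(X \in A, Y \in D, S \in C) = E_\theta[K(S)(A)\, 1_D(Y)\, 1_C(S)] \]
  (\<open>kernel_identity\<close>). Both sides are integrals of functions that do not involve $\theta$, so this
  integrates against the prior (\<open>nn_integral_joint_law\<close>) to the same identity under $Q$.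

  From there the argument concerns $Q$ alone (\<open>cond_exp_given_statistic\<close>). Taking $C$ to be the whole
  space gives $E[1_A(X) Y] = E[K(S)(A) Y]$, and since $K(S)(A)$ is a function of $S$ this equals
  $E[K(S)(A) E(Y \mid S)]$. Taking $D$ to be the whole space turns $K(S)(A)$ back into $1_A(X)$, so
  $E[1_A(X) Y] = E[1_A(X) E(Y \mid S)]$ for every $A$.

  If now $h(S)$ is a version of $E(Y \mid S)$, Pythagoras' theorem
  (\<open>mean_square_error_decomposition\<close>) shows that $h \circ S$ has minimal risk and that every other
  minimiser, in particular $p_0$, agrees with it $Q$-almost surely. This gives the first claim. The
  second one asks for agreement under every single $P_\theta$, which $Q$-null sets do not control: the
  prior may miss $\theta$. There the uniqueness hypothesis applies, to the Bayesian predictor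
  $h \circ S$.\<close>

section \<open>Conditioning on a random element\<close>

text \<open>The Doob--Dynkin lemma. It is needed because the conditional expectation given $S$ is a function
  on the space of $(X,Y,T)$, whereas a predictor has to be a function of $X$. For nonnegative functions
  the factor is built along the simple approximation; infinite values keep the supremum of the factors
  meaningful off the range of $Z$.\<close>

lemma vimage_algebra_factorization_ennreal:
  fixes u :: "'w \<Rightarrow> ennreal"
  assumes Z: "Z \<in> W \<rightarrow> space N"
    and u: "u \<in> borel_measurable (vimage_algebra W Z N)"
  shows "\<exists>h\<in>borel_measurable N. \<forall>w\<in>W. u w = h (Z w)"
  using u
proof (induction rule: borel_measurable_induct)
  case (cong f g)
  then show ?case by auto
next
  case (set A)
  then obtain C where C: "C \<in> sets N" "A = Z -` C \<inter> W"
    using sets_vimage_algebra2[OF Z] by auto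
  show ?case
    by (rule bexI[of _ "indicator C"]) (use C in \<open>auto simp: indicator_def\<close>)
next
  case (mult u c)
  then obtain h where "h \<in> borel_measurable N" "\<forall>w\<in>W. u w = h (Z w)" by blast
  then show ?case by (intro bexI[of _ "\<lambda>s. c * h s"]) auto
next
  case (add u v)
  then obtain h k where "h \<in> borel_measurable N" "\<forall>w\<in>W. u w = h (Z w)"
    and "k \<in> borel_measurable N" "\<forall>w\<in>W. v w = k (Z w)" by blast
  then show ?case by (intro bexI[of _ "\<lambda>s. k s + h s"]) auto
next
  case (seq U)
  then obtain H where H: "\<And>i. H i \<in> borel_measurable N" "\<And>i w. w \<in> W \<Longrightarrow> U i w = H i (Z w)"
    by metis
  show ?case
    by (rule bexI[of _ "\<lambda>s. SUP i. H i s"]) (use H in \<open>auto simp: image_comp\<close>)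
qed

lemma vimage_algebra_factorization:
  fixes u :: "'w \<Rightarrow> real"
  assumes Z: "Z \<in> W \<rightarrow> space N"
    and u [measurable]: "u \<in> borel_measurable (vimage_algebra W Z N)"
  obtains h where "h \<in> borel_measurable N" "\<And>w. w \<in> W \<Longrightarrow> u w = h (Z w)"
proof -
  obtain h where h [measurable]: "h \<in> borel_measurable N" "\<forall>w\<in>W. ennreal (u w) = h (Z w)"
    using vimage_algebra_factorization_ennreal[OF Z, of "\<lambda>w. ennreal (u w)"] by auto
  obtain k where k [measurable]: "k \<in> borel_measurable N" "\<forall>w\<in>W. ennreal (- u w) = k (Z w)"
    using vimage_algebra_factorization_ennreal[OF Z, of "\<lambda>w. ennreal (- u w)"] by auto
  have "u w = enn2real (h (Z w)) - enn2real (k (Z w))" if "w \<in> W" for w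
  proof -
    have "u w = enn2real (ennreal (u w)) - enn2real (ennreal (- u w))"
      by (cases "0 \<le> u w") (auto simp: ennreal_neg)
    then show ?thesis using h(2) k(2) that by simp
  qed
  then show ?thesis
    by (intro that[of "\<lambda>s. enn2real (h s) - enn2real (k s)"]) auto
qed

lemma finite_measure_subalgebra_vimage:
  assumes "finite_measure M" "Z \<in> M \<rightarrow>\<^sub>M N"
  shows "finite_measure_subalgebra M (vimage_algebra (space M) Z N)"
proof -
  have "subalgebra M (vimage_algebra (space M) Z N)"
    unfolding subalgebra_def
    using sets_vimage_algebra2[of Z "space M" N] assms(2) measurable_space[OF assms(2)]
    by (auto intro: measurable_sets)
  then show ?thesis
    using assms(1) by (simp add: finite_measure_subalgebra_def finite_measure_subalgebra_axioms_def)
qed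

lemma measurable_vimage_algebra_comp:
  assumes "Z \<in> M \<rightarrow>\<^sub>M N" "h \<in> N \<rightarrow>\<^sub>M R"
  shows "(\<lambda>w. h (Z w)) \<in> vimage_algebra (space M) Z N \<rightarrow>\<^sub>M R"
  by (rule measurable_compose[OF measurable_vimage_algebra1 assms(2)])
     (use measurable_space[OF assms(1)] in auto)

lemma cond_exp_given_AE_eqI:
  assumes "finite_measure M" and Z [measurable]: "Z \<in> M \<rightarrow>\<^sub>M N" and h: "h \<in> borel_measurable N"
    and W: "integrable M W" and hZ: "integrable M (\<lambda>w. h (Z w))"
    and eq: "\<And>C. C \<in> sets N \<Longrightarrow>
      (\<integral>w. indicator C (Z w) * W w \<partial>M) = (\<integral>w. indicator C (Z w) * h (Z w) \<partial>M)"
  shows "AE w in M. cond_exp_given M N Z W w = h (Z w)"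
proof -
  let ?F = "vimage_algebra (space M) Z N"
  interpret finite_measure_subalgebra M ?F
    by (rule finite_measure_subalgebra_vimage[OF assms(1) Z])
  show ?thesis
    unfolding cond_exp_given_def
  proof (rule real_cond_exp_charact[OF _ W hZ measurable_vimage_algebra_comp[OF Z h]])
    fix A assume "A \<in> sets ?F"
    then obtain C where C: "C \<in> sets N" "A = Z -` C \<inter> space M"
      using sets_vimage_algebra2[of Z "space M" N] measurable_space[OF Z] by auto
    have ind: "set_lebesgue_integral M A g = (\<integral>w. indicator C (Z w) * g w \<partial>M)" for g :: "_ \<Rightarrow> real"
      unfolding set_lebesgue_integral_def C(2)
      by (intro Bochner_Integration.integral_cong) (auto simp: indicator_def)
    show "set_lebesgue_integral M A W = set_lebesgue_integral M A (\<lambda>w. h (Z w))"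
      unfolding ind by (rule eq[OF C(1)])
  qed
qed

lemma cond_exp_given_integral:
  fixes W :: "'w \<Rightarrow> real"
  assumes "finite_measure M" and Z: "Z \<in> M \<rightarrow>\<^sub>M N" and "k \<in> borel_measurable N"
    and "W \<in> borel_measurable M" "integrable M (\<lambda>w. k (Z w) * W w)"
  shows "(\<integral>w. k (Z w) * cond_exp_given M N Z W w \<partial>M) = (\<integral>w. k (Z w) * W w \<partial>M)"
proof -
  interpret finite_measure_subalgebra M "vimage_algebra (space M) Z N"
    by (rule finite_measure_subalgebra_vimage[OF assms(1) Z])
  show ?thesis
    unfolding cond_exp_given_def
    by (rule real_cond_exp_intg(2)[OF assms(5) measurable_vimage_algebra_comp[OF Z assms(3)] assms(4)])
qed

text \<open>The measures with densities $u$ and $v$ have the same image under $Z$. The statement needs no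
  integrability because integrals that fail to exist do so on both sides.\<close>

lemma integral_mult_eq_from_events:
  fixes u v :: "'w \<Rightarrow> real" and g :: "'s \<Rightarrow> real"
  assumes u [measurable]: "u \<in> borel_measurable M" and v [measurable]: "v \<in> borel_measurable M"
    and nn: "AE w in M. 0 \<le> u w" "AE w in M. 0 \<le> v w"
    and Z [measurable]: "Z \<in> M \<rightarrow>\<^sub>M N" and g [measurable]: "g \<in> borel_measurable N"
    and eq: "\<And>C. C \<in> sets N \<Longrightarrow>
      (\<integral>\<^sup>+w. ennreal (u w) * indicator C (Z w) \<partial>M) = (\<integral>\<^sup>+w. ennreal (v w) * indicator C (Z w) \<partial>M)"
  shows "(\<integral>w. u w * g (Z w) \<partial>M) = (\<integral>w. v w * g (Z w) \<partial>M)"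
proof -
  have em: "emeasure (distr (density M (\<lambda>w. ennreal (k w))) N Z) C
      = (\<integral>\<^sup>+w. ennreal (k w) * indicator C (Z w) \<partial>M)"
    if [measurable]: "k \<in> borel_measurable M" and C [measurable]: "C \<in> sets N" for k :: "_ \<Rightarrow> real" and C
  proof -
    have "emeasure (distr (density M (\<lambda>w. ennreal (k w))) N Z) C
      = emeasure (density M (\<lambda>w. ennreal (k w))) (Z -` C \<inter> space M)"
      by (subst emeasure_distr) auto
    also have "\<dots> = (\<integral>\<^sup>+w. ennreal (k w) * indicator (Z -` C \<inter> space M) w \<partial>M)"
      by (rule emeasure_density) auto
    also have "\<dots> = (\<integral>\<^sup>+w. ennreal (k w) * indicator C (Z w) \<partial>M)"
      by (intro nn_integral_cong) (auto simp: indicator_def)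
    finally show ?thesis .
  qed
  have law: "distr (density M (\<lambda>w. ennreal (u w))) N Z = distr (density M (\<lambda>w. ennreal (v w))) N Z"
    by (rule measure_eqI) (auto simp: em eq)
  have "(\<integral>w. k w * g (Z w) \<partial>M) = (\<integral>s. g s \<partial>distr (density M (\<lambda>w. ennreal (k w))) N Z)"
    if [measurable]: "k \<in> borel_measurable M" and "AE w in M. 0 \<le> k w" for k :: "_ \<Rightarrow> real"
    using that by (subst integral_distr) (auto simp: integral_density)
  then show ?thesis using law nn by simp
qed

lemma integrable_mult_of_squares:
  fixes a b :: "'w \<Rightarrow> real"
  assumes [measurable]: "a \<in> borel_measurable M" "b \<in> borel_measurable M"
    and "integrable M (\<lambda>w. (a w)\<^sup>2)" "integrable M (\<lambda>w. (b w)\<^sup>2)"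
  shows "integrable M (\<lambda>w. a w * b w)"
proof (rule Bochner_Integration.integrable_bound)
  show "integrable M (\<lambda>w. (a w)\<^sup>2 + (b w)\<^sup>2)" using assms by simp
  have "\<bar>x * y\<bar> \<le> x\<^sup>2 + y\<^sup>2" for x y :: real
  proof -
    have "2 * (\<bar>x\<bar> * \<bar>y\<bar>) \<le> x\<^sup>2 + y\<^sup>2"
      using sum_squares_bound[of "\<bar>x\<bar>" "\<bar>y\<bar>"] by (simp add: mult.assoc)
    moreover have "0 \<le> \<bar>x\<bar> * \<bar>y\<bar>" by simp
    ultimately show ?thesis unfolding abs_mult by linarith
  qed
  then show "AE w in M. norm (a w * b w) \<le> norm ((a w)\<^sup>2 + (b w)\<^sup>2)"
    by (auto intro!: AE_I2 order_trans[OF _ abs_ge_self])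
qed measurable

lemma square_integrable_cond_exp_given:
  assumes M: "finite_measure M" and Z: "Z \<in> M \<rightarrow>\<^sub>M N"
    and W: "W \<in> borel_measurable M" "integrable M (\<lambda>w. (W w)\<^sup>2)"
  shows "integrable M (\<lambda>w. (cond_exp_given M N Z W w)\<^sup>2)"
proof -
  interpret finite_measure_subalgebra M "vimage_algebra (space M) Z N"
    by (rule finite_measure_subalgebra_vimage[OF M Z])
  have "integrable M W" using square_integrable_imp_integrable[OF W] .
  then show ?thesis
    unfolding cond_exp_given_def
    by (rule integrable_convex_cond_exp[where I = UNIV and q = "\<lambda>x. x\<^sup>2"])
       (use W in \<open>auto simp: convex_power2\<close>)
qed

lemma cond_exp_given_factorization:
  assumes M: "finite_measure M" and Z: "Z \<in> M \<rightarrow>\<^sub>M N"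
  obtains h where "h \<in> borel_measurable N"
    "\<And>w. w \<in> space M \<Longrightarrow> cond_exp_given M N Z W w = h (Z w)"
proof -
  have "cond_exp_given M N Z W \<in> borel_measurable (vimage_algebra (space M) Z N)"
    unfolding cond_exp_given_def by (rule borel_measurable_cond_exp)
  then show ?thesis
    using vimage_algebra_factorization[of Z "space M" N] measurable_space[OF Z] that by blast
qed

text \<open>The residual $g(X) - W$ is orthogonal to all square integrable functions of $X$, so the cross
  term of the expanded square vanishes.\<close>

lemma mean_square_error_decomposition:
  fixes W :: "'w \<Rightarrow> real"
  assumes M: "finite_measure M" and X [measurable]: "X \<in> M \<rightarrow>\<^sub>M L"
    and W [measurable]: "W \<in> borel_measurable M" and W2: "integrable M (\<lambda>w. (W w)\<^sup>2)"
    and g [measurable]: "g \<in> borel_measurable L" and g2: "integrable M (\<lambda>w. (g (X w))\<^sup>2)"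
    and reg: "AE w in M. cond_exp_given M L X W w = g (X w)"
    and p [measurable]: "p \<in> borel_measurable L" and p2: "integrable M (\<lambda>w. (p (X w))\<^sup>2)"
  shows "(\<integral>w. (p (X w) - W w)\<^sup>2 \<partial>M)
      = (\<integral>w. (p (X w) - g (X w))\<^sup>2 \<partial>M) + (\<integral>w. (g (X w) - W w)\<^sup>2 \<partial>M)"
    and "integrable M (\<lambda>w. (p (X w) - g (X w))\<^sup>2)"
proof -
  let ?d = "\<lambda>x. p x - g x"
  note prods = integrable_mult_of_squares[of _ M]
  have pg: "integrable M (\<lambda>w. p (X w) * g (X w))" and gW: "integrable M (\<lambda>w. g (X w) * W w)"
    and pW: "integrable M (\<lambda>w. p (X w) * W w)"
    by (intro prods p2 g2 W2; measurable)+
  show d2: "integrable M (\<lambda>w. (p (X w) - g (X w))\<^sup>2)"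
    unfolding power2_diff using p2 g2 pg by (simp add: mult.assoc)
  have e2: "integrable M (\<lambda>w. (g (X w) - W w)\<^sup>2)"
    unfolding power2_diff using g2 W2 gW by (simp add: mult.assoc)
  have dW: "integrable M (\<lambda>w. ?d (X w) * W w)"
    unfolding left_diff_distrib using pW gW by simp
  have dg: "integrable M (\<lambda>w. ?d (X w) * g (X w))"
    unfolding left_diff_distrib using pg g2 by (simp add: power2_eq_square)
  have [measurable]: "cond_exp_given M L X W \<in> borel_measurable M"
    unfolding cond_exp_given_def by simp
  have "(\<integral>w. ?d (X w) * W w \<partial>M) = (\<integral>w. ?d (X w) * cond_exp_given M L X W w \<partial>M)"
    by (rule cond_exp_given_integral[OF M X _ W dW, symmetric]) measurable
  also have "\<dots> = (\<integral>w. ?d (X w) * g (X w) \<partial>M)"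
    using reg by (intro integral_cong_AE) auto
  finally have orth: "(\<integral>w. ?d (X w) * W w \<partial>M) = (\<integral>w. ?d (X w) * g (X w) \<partial>M)" .
  have "(\<integral>w. (p (X w) - W w)\<^sup>2 \<partial>M)
      = (\<integral>w. ((?d (X w))\<^sup>2 + (g (X w) - W w)\<^sup>2) + 2 * (?d (X w) * g (X w) - ?d (X w) * W w) \<partial>M)"
    by (intro Bochner_Integration.integral_cong) (auto simp: power2_eq_square algebra_simps)
  also have "\<dots> = (\<integral>w. (?d (X w))\<^sup>2 \<partial>M) + (\<integral>w. (g (X w) - W w)\<^sup>2 \<partial>M)"
    using d2 e2 dg dW orth by simp
  finally show "(\<integral>w. (p (X w) - W w)\<^sup>2 \<partial>M)
      = (\<integral>w. (?d (X w))\<^sup>2 \<partial>M) + (\<integral>w. (g (X w) - W w)\<^sup>2 \<partial>M)" .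
qed

section \<open>Regression on a sufficient statistic\<close>

text \<open>The family $t$ stands for the kernel $K(s)(A)$. The hypothesis \<open>kernel\<close> packs two facts into one:
  with \<open>C = space N\<close> it is conditional independence in the form needed for $V$, and with
  \<open>D = space B\<close> it says that $t_A(S)$ is a conditional probability of $A$. It is stated with
  nonnegative integrals, since these can be mixed over a prior without integrability concerns.\<close>

lemma cond_exp_given_statistic:
  fixes V :: "'w \<Rightarrow> real" and t :: "'x set \<Rightarrow> 's \<Rightarrow> real"
  assumes M: "finite_measure M" and U [measurable]: "U \<in> M \<rightarrow>\<^sub>M L" and S [measurable]: "S \<in> L \<rightarrow>\<^sub>M N"
    and V [measurable]: "V \<in> M \<rightarrow>\<^sub>M B" and B: "(\<lambda>y. y) \<in> borel_measurable B"
    and intV: "integrable M V"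
    and t: "\<And>A. A \<in> sets L \<Longrightarrow> t A \<in> borel_measurable N"
    and t01: "\<And>A s. A \<in> sets L \<Longrightarrow> s \<in> space N \<Longrightarrow> 0 \<le> t A s \<and> t A s \<le> 1"
    and kernel: "\<And>A D C. A \<in> sets L \<Longrightarrow> D \<in> sets B \<Longrightarrow> C \<in> sets N \<Longrightarrow>
      (\<integral>\<^sup>+w. indicator A (U w) * (indicator D (V w) * indicator C (S (U w))) \<partial>M)
        = (\<integral>\<^sup>+w. ennreal (t A (S (U w))) * (indicator D (V w) * indicator C (S (U w))) \<partial>M)"
    and h: "h \<in> borel_measurable N"
    and reg: "AE w in M. cond_exp_given M N (\<lambda>w. S (U w)) V w = h (S (U w))"
  shows "AE w in M. cond_exp_given M L U V w = h (S (U w))"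
proof (rule cond_exp_given_AE_eqI[OF M U _ intV])
  note [measurable] = h
  let ?Z = "\<lambda>w. S (U w)"
  have Z: "?Z \<in> M \<rightarrow>\<^sub>M N" by measurable
  show "(\<lambda>x. h (S x)) \<in> borel_measurable L" by measurable
  interpret sub: finite_measure_subalgebra M "vimage_algebra (space M) ?Z N"
    by (rule finite_measure_subalgebra_vimage[OF M Z])
  have [measurable]: "cond_exp_given M N ?Z V \<in> borel_measurable M"
    unfolding cond_exp_given_def by simp
  have "integrable M (cond_exp_given M N ?Z V)"
    unfolding cond_exp_given_def by (rule sub.real_cond_exp_int(1)[OF intV])
  then show "integrable M (\<lambda>w. h (S (U w)))"
    by (rule integrable_cong_AE_imp) (use reg in auto)
  have [measurable]: "V \<in> borel_measurable M"
    using intV by auto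
  fix A assume A [measurable]: "A \<in> sets L"
  note [measurable] = t[OF A]
  have pos: "AE w in M. 0 \<le> t A (?Z w)"
    using t01[OF A] measurable_space[OF Z] by auto
  have ind: "ennreal (indicator A (U w)) = indicator A (U w)" for w
    by (auto simp: indicator_def)
  have "(\<integral>w. indicator A (U w) * V w \<partial>M) = (\<integral>w. t A (?Z w) * V w \<partial>M)"
  proof (rule integral_mult_eq_from_events[OF _ _ _ pos V B])
    fix D assume D: "D \<in> sets B"
    have sp: "indicator (space N) (?Z w) = (1::ennreal)" if "w \<in> space M" for w
      using measurable_space[OF Z that] by simp
    have "(\<integral>\<^sup>+w. ennreal (k w) * (indicator D (V w) * indicator (space N) (?Z w)) \<partial>M)
        = (\<integral>\<^sup>+w. ennreal (k w) * indicator D (V w) \<partial>M)" for k :: "_ \<Rightarrow> real"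
      by (intro nn_integral_cong) (simp add: sp)
    from this[of "\<lambda>w. indicator A (U w)"] this[of "\<lambda>w. t A (?Z w)"] kernel[OF A D sets.top]
    show "(\<integral>\<^sup>+w. ennreal (indicator A (U w)) * indicator D (V w) \<partial>M)
        = (\<integral>\<^sup>+w. ennreal (t A (?Z w)) * indicator D (V w) \<partial>M)"
      by (simp add: ind)
  qed auto
  also have "\<dots> = (\<integral>w. t A (?Z w) * cond_exp_given M N ?Z V w \<partial>M)"
  proof (rule cond_exp_given_integral[OF M Z t[OF A], symmetric])
    show "integrable M (\<lambda>w. t A (?Z w) * V w)"
    proof (rule Bochner_Integration.integrable_bound[OF intV])
      show "AE w in M. norm (t A (?Z w) * V w) \<le> norm (V w)"
        using t01[OF A] measurable_space[OF Z]
        by (auto simp: abs_mult intro!: AE_I2 mult_left_le_one_le)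
    qed measurable
  qed measurable
  also have "\<dots> = (\<integral>w. t A (?Z w) * h (?Z w) \<partial>M)"
    using reg by (intro integral_cong_AE) auto
  also have "\<dots> = (\<integral>w. indicator A (U w) * h (?Z w) \<partial>M)"
  proof (rule integral_mult_eq_from_events[OF _ _ pos _ Z h])
    fix C assume C: "C \<in> sets N"
    have sp: "indicator (space B) (V w) = (1::ennreal)" if "w \<in> space M" for w
      using measurable_space[OF V that] by simp
    have "(\<integral>\<^sup>+w. ennreal (k w) * (indicator (space B) (V w) * indicator C (?Z w)) \<partial>M)
        = (\<integral>\<^sup>+w. ennreal (k w) * indicator C (?Z w) \<partial>M)" for k :: "_ \<Rightarrow> real"
      by (intro nn_integral_cong) (simp add: sp)
    from this[of "\<lambda>w. indicator A (U w)"] this[of "\<lambda>w. t A (?Z w)"] kernel[OF A sets.top C]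
    show "(\<integral>\<^sup>+w. ennreal (t A (?Z w)) * indicator C (?Z w) \<partial>M)
        = (\<integral>\<^sup>+w. ennreal (indicator A (U w)) * indicator C (?Z w) \<partial>M)"
      by (simp add: ind)
  qed auto
  finally show "(\<integral>w. indicator A (U w) * V w \<partial>M) = (\<integral>w. indicator A (U w) * h (S (U w)) \<partial>M)" .
qed

lemma cond_distribution_kernel:
  assumes "cond_distribution (distr M L U) N S K"
  shows "A \<in> sets L \<Longrightarrow> (\<lambda>s. measure (K s) A) \<in> borel_measurable N"
    and "s \<in> space N \<Longrightarrow> prob_space (K s)"
proof -
  have K: "K \<in> N \<rightarrow>\<^sub>M prob_algebra (distr M L U)"
    using assms by (simp add: cond_distribution_def)
  show "A \<in> sets L \<Longrightarrow> (\<lambda>s. measure (K s) A) \<in> borel_measurable N"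
    by (rule measurable_compose[OF K measurable_measure_prob_algebra]) simp
  show "s \<in> space N \<Longrightarrow> prob_space (K s)"
    using measurable_space[OF K] by (simp add: space_prob_algebra)
qed

text \<open>The kernel is specified on the image space of $U$; this carries it back to the space on which
  $U$ and $V$ are both defined, where it can be combined with conditional independence.\<close>

lemma cond_exp_given_indicator_kernel:
  assumes M: "prob_space M" and U [measurable]: "U \<in> M \<rightarrow>\<^sub>M L" and S [measurable]: "S \<in> L \<rightarrow>\<^sub>M N"
    and K: "cond_distribution (distr M L U) N S K" and A [measurable]: "A \<in> sets L"
  shows "AE w in M. cond_exp_given M N (\<lambda>w. S (U w)) (\<lambda>w. indicator A (U w)) w
    = measure (K (S (U w))) A"
proof -
  interpret prob_space M by fact
  interpret D: prob_space "distr M L U" by (rule prob_space_distr[OF U])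
  note t [measurable] = cond_distribution_kernel(1)[OF K A]
  have S': "S \<in> distr M L U \<rightarrow>\<^sub>M N" by simp
  have K1: "measure (K s) A \<le> 1" if "s \<in> space N" for s
    using prob_space.prob_le_1[OF cond_distribution_kernel(2)[OF K that]] by auto
  have bd: "measure (K (S (U w))) A \<le> 1" if "w \<in> space M" for w
    using that measurable_space[OF U] measurable_space[OF S] by (auto intro: K1)
  show ?thesis
  proof (rule cond_exp_given_AE_eqI)
    show "integrable M (\<lambda>w. indicator A (U w) :: real)"
      by (rule integrable_const_bound[where B = 1]) (auto simp: indicator_def)
    show "integrable M (\<lambda>w. measure (K (S (U w))) A)"
      by (rule integrable_const_bound[where B = 1]) (auto intro!: AE_I2 bd)
    fix C assume C [measurable]: "C \<in> sets N"
    have [measurable]: "cond_exp_given (distr M L U) N S (indicator A) \<in> borel_measurable (distr M L U)"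
      unfolding cond_exp_given_def by simp
    have "(\<integral>w. indicator C (S (U w)) * indicator A (U w) \<partial>M)
        = (\<integral>x. indicator C (S x) * indicator A x \<partial>distr M L U :: real)"
      by (subst integral_distr) auto
    also have "\<dots> = (\<integral>x. indicator C (S x) * cond_exp_given (distr M L U) N S (indicator A) x \<partial>distr M L U)"
      by (rule cond_exp_given_integral[OF D.finite_measure_axioms S', symmetric])
         (auto intro!: D.integrable_const_bound[where B = 1] simp: indicator_def)
    also have "\<dots> = (\<integral>x. indicator C (S x) * measure (K (S x)) A \<partial>distr M L U)"
    proof (rule integral_cong_AE)
      have "AE x in distr M L U. measure (K (S x)) A = cond_exp_given (distr M L U) N S (indicator A) x"
        using K A by (simp add: cond_distribution_def)
      then show "AE x in distr M L U.
          indicator C (S x) * cond_exp_given (distr M L U) N S (indicator A) x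
          = indicator C (S x) * measure (K (S x)) A"
        by auto
    qed auto
    also have "\<dots> = (\<integral>w. indicator C (S (U w)) * measure (K (S (U w))) A \<partial>M)"
      by (subst integral_distr) auto
    finally show "(\<integral>w. indicator C (S (U w)) * indicator A (U w) \<partial>M)
        = (\<integral>w. indicator C (S (U w)) * measure (K (S (U w))) A \<partial>M)" .
  qed (auto intro: finite_measure_axioms)
qed

text \<open>Conditioning on $S$, the product $1_A(U) 1_D(V)$ may be replaced by the product of the two
  conditional probabilities; the first of them is the kernel, a function of $S$, so the conditioning
  of the remaining factor $1_D(V)$ can be undone.\<close>

lemma kernel_identity:
  assumes M: "prob_space M" and U [measurable]: "U \<in> M \<rightarrow>\<^sub>M L" and S [measurable]: "S \<in> L \<rightarrow>\<^sub>M N"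
    and V [measurable]: "V \<in> M \<rightarrow>\<^sub>M B"
    and K: "cond_distribution (distr M L U) N S K"
    and ci: "cond_indep_given M N (\<lambda>w. S (U w)) L U B V"
    and A [measurable]: "A \<in> sets L" and D [measurable]: "D \<in> sets B" and C [measurable]: "C \<in> sets N"
  shows "(\<integral>\<^sup>+w. indicator A (U w) * (indicator D (V w) * indicator C (S (U w))) \<partial>M)
    = (\<integral>\<^sup>+w. ennreal (measure (K (S (U w))) A) * (indicator D (V w) * indicator C (S (U w))) \<partial>M)"
proof -
  interpret prob_space M by fact
  let ?Z = "\<lambda>w. S (U w)"
  let ?a = "\<lambda>w. indicator A (U w) :: real" and ?d = "\<lambda>w. indicator D (V w) :: real"
  let ?c = "\<lambda>s. indicator C s :: real"
  let ?t = "\<lambda>s. measure (K s) A"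
  note t [measurable] = cond_distribution_kernel(1)[OF K A]
  have Z: "?Z \<in> M \<rightarrow>\<^sub>M N" by measurable
  have t1: "?t (?Z w) \<le> 1" if "w \<in> space M" for w
    using prob_space.prob_le_1[OF cond_distribution_kernel(2)[OF K measurable_space[OF Z that]]]
    by auto
  have [measurable]: "cond_exp_given M N ?Z W \<in> borel_measurable M" for W
    unfolding cond_exp_given_def by simp
  have int1: "integrable M (\<lambda>w. ?a w * (?d w * ?c (?Z w)))"
    by (rule integrable_const_bound[where B = 1]) (auto simp: indicator_def)
  have int2: "integrable M (\<lambda>w. ?t (?Z w) * (?d w * ?c (?Z w)))"
    by (rule integrable_const_bound[where B = 1]) (auto intro!: AE_I2 t1 simp: indicator_def)
  have "(\<integral>w. ?a w * (?d w * ?c (?Z w)) \<partial>M) = (\<integral>w. ?c (?Z w) * (?a w * ?d w) \<partial>M)"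
    by (simp add: mult_ac)
  also have "\<dots> = (\<integral>w. ?c (?Z w) * cond_exp_given M N ?Z (\<lambda>w. ?a w * ?d w) w \<partial>M)"
    by (rule cond_exp_given_integral[OF finite_measure_axioms Z, symmetric])
       (use int1 in \<open>auto simp: mult_ac\<close>)
  also have "\<dots> = (\<integral>w. (?c (?Z w) * ?t (?Z w)) * cond_exp_given M N ?Z ?d w \<partial>M)"
  proof (rule integral_cong_AE)
    have "AE w in M. cond_exp_given M N ?Z (\<lambda>w. ?a w * ?d w) w
        = cond_exp_given M N ?Z ?a w * cond_exp_given M N ?Z ?d w"
      using ci A D by (simp add: cond_indep_given_def)
    with cond_exp_given_indicator_kernel[OF M U S K A]
    show "AE w in M. ?c (?Z w) * cond_exp_given M N ?Z (\<lambda>w. ?a w * ?d w) w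
        = ?c (?Z w) * ?t (?Z w) * cond_exp_given M N ?Z ?d w"
      by eventually_elim simp
  qed auto
  also have "\<dots> = (\<integral>w. (?c (?Z w) * ?t (?Z w)) * ?d w \<partial>M)"
    by (rule cond_exp_given_integral[OF finite_measure_axioms Z, where k = "\<lambda>s. ?c s * ?t s"])
       (use int2 in \<open>auto simp: mult_ac\<close>)
  also have "\<dots> = (\<integral>w. ?t (?Z w) * (?d w * ?c (?Z w)) \<partial>M)"
    by (simp add: mult_ac)
  finally have eq: "(\<integral>w. ?a w * (?d w * ?c (?Z w)) \<partial>M) = (\<integral>w. ?t (?Z w) * (?d w * ?c (?Z w)) \<partial>M)" .
  have "(\<integral>\<^sup>+w. indicator A (U w) * (indicator D (V w) * indicator C (?Z w)) \<partial>M)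
      = (\<integral>\<^sup>+w. ennreal (?a w * (?d w * ?c (?Z w))) \<partial>M)"
    by (intro nn_integral_cong) (auto simp: indicator_def)
  also have "\<dots> = ennreal (\<integral>w. ?a w * (?d w * ?c (?Z w)) \<partial>M)"
    by (rule nn_integral_eq_integral[OF int1]) auto
  also have "\<dots> = (\<integral>\<^sup>+w. ennreal (?t (?Z w) * (?d w * ?c (?Z w))) \<partial>M)"
    unfolding eq by (rule nn_integral_eq_integral[OF int2, symmetric]) auto
  also have "\<dots> = (\<integral>\<^sup>+w. ennreal (?t (?Z w)) * (indicator D (V w) * indicator C (?Z w)) \<partial>M)"
    by (intro nn_integral_cong) (auto simp: indicator_def)
  finally show ?thesis .
qed

section \<open>The joint law as a mixture over the prior\<close>

lemma
  assumes bm: "bayes_model lam mu nu \<Theta> f \<phi>"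
  shows space_prior: "space nu = \<Theta>"
    and sets_joint_law: "sets (joint_law lam mu nu f \<phi>) = sets ((lam \<Otimes>\<^sub>M mu) \<Otimes>\<^sub>M nu)"
    and sets_model: "sets (model lam mu f \<theta>) = sets (lam \<Otimes>\<^sub>M mu)"
proof -
  have "sets nu = sets (restrict_space borel \<Theta>)"
    using bm by (simp add: bayes_model_def)
  then show "space nu = \<Theta>"
    by (auto dest!: sets_eq_imp_space_eq simp: space_restrict_space)
qed (simp_all add: joint_law_def model_def)

lemma nn_integral_joint_law:
  assumes bm: "bayes_model lam mu nu \<Theta> f \<phi>" and g [measurable]: "g \<in> borel_measurable (lam \<Otimes>\<^sub>M mu)"
  shows "(\<integral>\<^sup>+\<omega>. g (fst \<omega>) \<partial>joint_law lam mu nu f \<phi>)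
    = (\<integral>\<^sup>+\<theta>. ennreal (\<phi> \<theta>) * (\<integral>\<^sup>+z. g z \<partial>model lam mu f \<theta>) \<partial>nu)"
proof -
  have sf: "sigma_finite_measure lam" "sigma_finite_measure mu" "sigma_finite_measure nu"
    and f: "(\<lambda>((x, y), \<theta>). f x y \<theta>) \<in> borel_measurable ((lam \<Otimes>\<^sub>M mu) \<Otimes>\<^sub>M nu)"
    and \<phi> [measurable]: "\<phi> \<in> borel_measurable nu" and \<phi>0: "\<And>\<theta>. \<theta> \<in> \<Theta> \<Longrightarrow> 0 \<le> \<phi> \<theta>"
    using bm by (auto simp: bayes_model_def)
  interpret l: sigma_finite_measure lam by fact
  interpret m: sigma_finite_measure mu by fact
  interpret n: sigma_finite_measure nu by fact
  interpret lm: pair_sigma_finite lam mu ..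
  interpret lmn: pair_sigma_finite "lam \<Otimes>\<^sub>M mu" nu ..
  define F where "F = (\<lambda>p. f (fst (fst p)) (snd (fst p)) (snd p))"
  have F [measurable]: "F \<in> borel_measurable ((lam \<Otimes>\<^sub>M mu) \<Otimes>\<^sub>M nu)"
    using f by (simp add: F_def case_prod_beta')
  have J: "joint_law lam mu nu f \<phi> = density ((lam \<Otimes>\<^sub>M mu) \<Otimes>\<^sub>M nu) (\<lambda>p. ennreal (F p * \<phi> (snd p)))"
    by (simp add: joint_law_def F_def case_prod_beta')
  have P: "model lam mu f \<theta> = density (lam \<Otimes>\<^sub>M mu) (\<lambda>z. ennreal (F (z, \<theta>)))" for \<theta>
    by (simp add: model_def F_def case_prod_beta')
  have "(\<integral>\<^sup>+\<omega>. g (fst \<omega>) \<partial>joint_law lam mu nu f \<phi>)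
      = (\<integral>\<^sup>+p. ennreal (F p * \<phi> (snd p)) * g (fst p) \<partial>((lam \<Otimes>\<^sub>M mu) \<Otimes>\<^sub>M nu))"
    unfolding J by (rule nn_integral_density) measurable
  also have "\<dots> = (\<integral>\<^sup>+\<theta>. (\<integral>\<^sup>+z. ennreal (F (z, \<theta>) * \<phi> \<theta>) * g z \<partial>(lam \<Otimes>\<^sub>M mu)) \<partial>nu)"
    by (subst lmn.nn_integral_snd[symmetric]) auto
  also have "\<dots> = (\<integral>\<^sup>+\<theta>. ennreal (\<phi> \<theta>) * (\<integral>\<^sup>+z. g z \<partial>model lam mu f \<theta>) \<partial>nu)"
  proof (rule nn_integral_cong)
    fix \<theta> assume \<theta> [measurable]: "\<theta> \<in> space nu"
    then have "0 \<le> \<phi> \<theta>" using \<phi>0 space_prior[OF bm] by simp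
    then have "(\<integral>\<^sup>+z. ennreal (F (z, \<theta>) * \<phi> \<theta>) * g z \<partial>(lam \<Otimes>\<^sub>M mu))
        = (\<integral>\<^sup>+z. ennreal (\<phi> \<theta>) * (ennreal (F (z, \<theta>)) * g z) \<partial>(lam \<Otimes>\<^sub>M mu))"
      by (intro nn_integral_cong) (simp add: ennreal_mult' mult_ac)
    also have "\<dots> = ennreal (\<phi> \<theta>) * (\<integral>\<^sup>+z. ennreal (F (z, \<theta>)) * g z \<partial>(lam \<Otimes>\<^sub>M mu))"
      by (rule nn_integral_cmult) measurable
    also have "(\<integral>\<^sup>+z. ennreal (F (z, \<theta>)) * g z \<partial>(lam \<Otimes>\<^sub>M mu)) = (\<integral>\<^sup>+z. g z \<partial>model lam mu f \<theta>)"
      unfolding P by (rule nn_integral_density[symmetric]) measurable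
    finally show "(\<integral>\<^sup>+z. ennreal (F (z, \<theta>) * \<phi> \<theta>) * g z \<partial>(lam \<Otimes>\<^sub>M mu))
        = ennreal (\<phi> \<theta>) * (\<integral>\<^sup>+z. g z \<partial>model lam mu f \<theta>)" .
  qed
  finally show ?thesis .
qed

lemma prob_space_joint_law:
  assumes bm: "bayes_model lam mu nu \<Theta> f \<phi>"
  shows "prob_space (joint_law lam mu nu f \<phi>)"
proof
  have \<phi> [measurable]: "\<phi> \<in> borel_measurable nu"
    and pr: "prob_space (density nu (\<lambda>\<theta>. ennreal (\<phi> \<theta>)))"
    and P: "\<And>\<theta>. \<theta> \<in> \<Theta> \<Longrightarrow> prob_space (model lam mu f \<theta>)"
    using bm by (auto simp: bayes_model_def)
  have "emeasure (joint_law lam mu nu f \<phi>) (space (joint_law lam mu nu f \<phi>))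
      = (\<integral>\<^sup>+\<omega>. 1 \<partial>joint_law lam mu nu f \<phi>)" by simp
  also have "\<dots> = (\<integral>\<^sup>+\<theta>. ennreal (\<phi> \<theta>) * (\<integral>\<^sup>+z. 1 \<partial>model lam mu f \<theta>) \<partial>nu)"
    by (rule nn_integral_joint_law[OF bm, where g = "\<lambda>_. 1"]) simp
  also have "\<dots> = (\<integral>\<^sup>+\<theta>. ennreal (\<phi> \<theta>) * indicator (space nu) \<theta> \<partial>nu)"
    using P space_prior[OF bm]
    by (intro nn_integral_cong) (simp add: prob_space.emeasure_space_1)
  also have "\<dots> = emeasure (density nu (\<lambda>\<theta>. ennreal (\<phi> \<theta>))) (space nu)"
    by (rule emeasure_density[symmetric]) auto
  also have "\<dots> = 1"
    using prob_space.emeasure_space_1[OF pr] by simp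
  finally show "emeasure (joint_law lam mu nu f \<phi>) (space (joint_law lam mu nu f \<phi>)) = 1" .
qed

section \<open>The Bayesian predictor\<close>

theorem proposition4p2:
  fixes lam :: "'x measure" and mu nu :: "real measure" and N :: "'s measure"
    and \<Theta> :: "real set" and f :: "'x \<Rightarrow> real \<Rightarrow> real \<Rightarrow> real" and \<phi> :: "real \<Rightarrow> real"
    and S :: "'x \<Rightarrow> 's" and p0 :: "'x \<Rightarrow> real"
  defines "P \<equiv> model lam mu f"
    and "Q \<equiv> joint_law lam mu nu f \<phi>"
  assumes "bayes_model lam mu nu \<Theta> f \<phi>"
    and "integrable Q (\<lambda>\<omega>. (Y_of \<omega>)\<^sup>2)"
    and "unique_bayesian_predictor lam Q \<Theta> P p0"
    and "Y_sufficient lam mu N \<Theta> P S"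
  shows "(AE \<omega> in Q. p0 (X_of \<omega>) = cond_exp_given Q N (\<lambda>\<omega>. S (X_of \<omega>)) Y_of \<omega>) \<and>
    (\<forall>h\<in>borel_measurable N.
       (AE \<omega> in Q. h (S (X_of \<omega>)) = cond_exp_given Q N (\<lambda>\<omega>. S (X_of \<omega>)) Y_of \<omega>) \<longrightarrow>
       (\<forall>\<theta>\<in>\<Theta>. AE (x, y) in P \<theta>. p0 x = h (S x)))"
proof -
  note bm = assms(3) and Y2 = assms(4)
  let ?Z = "\<lambda>\<omega>. S (X_of \<omega>)"
  let ?risk = "\<lambda>p. \<integral>\<omega>. (p (X_of \<omega>) - Y_of \<omega>)\<^sup>2 \<partial>Q"
  interpret Q: prob_space Q unfolding Q_def by (rule prob_space_joint_law[OF bm])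
  have fin: "finite_measure Q" by unfold_locales
  have sQ [measurable_cong]: "sets Q = sets ((lam \<Otimes>\<^sub>M mu) \<Otimes>\<^sub>M nu)"
    unfolding Q_def by (rule sets_joint_law[OF bm])
  have sP [measurable_cong]: "sets (P \<theta>) = sets (lam \<Otimes>\<^sub>M mu)" for \<theta>
    unfolding P_def by (rule sets_model[OF bm])
  have P: "prob_space (P \<theta>)" if "\<theta> \<in> \<Theta>" for \<theta>
    using bm that by (simp add: bayes_model_def P_def)
  have borelY: "(\<lambda>y. y) \<in> borel_measurable mu" using bm by (simp add: bayes_model_def)
  have S [measurable]: "S \<in> lam \<rightarrow>\<^sub>M N" using assms(6) by (simp add: Y_sufficient_def)
  have Xf: "X_of = (\<lambda>\<omega>. fst (fst \<omega>))" and Yf: "Y_of = (\<lambda>\<omega>. snd (fst \<omega>))"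
    by (auto simp: X_of_def Y_of_def)
  have X [measurable]: "X_of \<in> Q \<rightarrow>\<^sub>M lam" and Ymu: "Y_of \<in> Q \<rightarrow>\<^sub>M mu"
    unfolding Xf Yf by measurable
  have Y [measurable]: "Y_of \<in> borel_measurable Q"
    using measurable_compose[OF Ymu borelY] by simp
  have Z: "?Z \<in> Q \<rightarrow>\<^sub>M N" by measurable
  have intY: "integrable Q Y_of" by (rule Q.square_integrable_imp_integrable[OF Y Y2])
  \<comment> \<open>One kernel serves every parameter; without this the identity below would not survive mixing.\<close>
  obtain K where K: "\<And>\<theta>. \<theta> \<in> \<Theta> \<Longrightarrow> cond_distribution (distr (P \<theta>) lam fst) N S K"
    using assms(6) by (auto simp: Y_sufficient_def sufficient_statistic_def)
  have ci: "cond_indep_given (P \<theta>) N (\<lambda>z. S (fst z)) lam fst mu snd" if "\<theta> \<in> \<Theta>" for \<theta>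
    using assms(6) that by (simp add: Y_sufficient_def case_prod_beta')
  \<comment> \<open>The measurability of the kernel is only available through some parameter.\<close>
  have "\<Theta> \<noteq> {}"
  proof
    assume "\<Theta> = {}"
    then have "space nu = {}" using space_prior[OF bm] by simp
    moreover have "prob_space (density nu (\<lambda>\<theta>. ennreal (\<phi> \<theta>)))"
      using bm by (simp add: bayes_model_def)
    ultimately show False using prob_space.not_empty by fastforce
  qed
  then obtain \<theta>0 where \<theta>0: "\<theta>0 \<in> \<Theta>" by blast
  note tK [measurable] = cond_distribution_kernel(1)[OF K[OF \<theta>0]]
  have kernelQ: "(\<integral>\<^sup>+\<omega>. indicator A (X_of \<omega>) * (indicator D (Y_of \<omega>) * indicator C (?Z \<omega>)) \<partial>Q)
      = (\<integral>\<^sup>+\<omega>. ennreal (measure (K (?Z \<omega>)) A) * (indicator D (Y_of \<omega>) * indicator C (?Z \<omega>)) \<partial>Q)"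
    if A [measurable]: "A \<in> sets lam" and D [measurable]: "D \<in> sets mu"
      and C [measurable]: "C \<in> sets N" for A D C
  proof -
    have "(\<integral>\<^sup>+\<omega>. indicator A (X_of \<omega>) * (indicator D (Y_of \<omega>) * indicator C (?Z \<omega>)) \<partial>Q)
        = (\<integral>\<^sup>+\<theta>. ennreal (\<phi> \<theta>) * (\<integral>\<^sup>+z. indicator A (fst z) * (indicator D (snd z) * indicator C (S (fst z))) \<partial>P \<theta>) \<partial>nu)"
      unfolding Q_def P_def Xf Yf
      by (rule nn_integral_joint_law[OF bm]) measurable
    also have "\<dots> = (\<integral>\<^sup>+\<theta>. ennreal (\<phi> \<theta>) * (\<integral>\<^sup>+z. ennreal (measure (K (S (fst z))) A) * (indicator D (snd z) * indicator C (S (fst z))) \<partial>P \<theta>) \<partial>nu)"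
    proof (rule nn_integral_cong)
      fix \<theta> assume "\<theta> \<in> space nu"
      then have \<theta>: "\<theta> \<in> \<Theta>" using space_prior[OF bm] by simp
      show "ennreal (\<phi> \<theta>) * (\<integral>\<^sup>+z. indicator A (fst z) * (indicator D (snd z) * indicator C (S (fst z))) \<partial>P \<theta>)
        = ennreal (\<phi> \<theta>) * (\<integral>\<^sup>+z. ennreal (measure (K (S (fst z))) A) * (indicator D (snd z) * indicator C (S (fst z))) \<partial>P \<theta>)"
        by (subst kernel_identity[OF P[OF \<theta>] _ S _ K[OF \<theta>] ci[OF \<theta>] A D C]) auto
    qed
    also have "\<dots> = (\<integral>\<^sup>+\<omega>. ennreal (measure (K (?Z \<omega>)) A) * (indicator D (Y_of \<omega>) * indicator C (?Z \<omega>)) \<partial>Q)"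
      unfolding Q_def P_def Xf Yf
      by (rule nn_integral_joint_law[OF bm, symmetric]) measurable
    finally show ?thesis .
  qed
  have K01: "0 \<le> measure (K s) A \<and> measure (K s) A \<le> 1" if "s \<in> space N" for A s
    using prob_space.prob_le_1[OF cond_distribution_kernel(2)[OF K[OF \<theta>0] that]] by auto
  have minimal: "bayesian_predictor lam Q (\<lambda>x. h (S x))
      \<and> (AE \<omega> in Q. p0 (X_of \<omega>) = h (?Z \<omega>))"
    if h [measurable]: "h \<in> borel_measurable N"
      and hE: "AE \<omega> in Q. h (?Z \<omega>) = cond_exp_given Q N ?Z Y_of \<omega>" for h
  proof -
    let ?g = "\<lambda>x. h (S x)"
    have reg: "AE \<omega> in Q. cond_exp_given Q lam X_of Y_of \<omega> = ?g (X_of \<omega>)"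
      by (rule cond_exp_given_statistic[OF fin X S Ymu borelY intY tK _ kernelQ h])
         (use hE K01 in auto)
    have g2: "integrable Q (\<lambda>\<omega>. (?g (X_of \<omega>))\<^sup>2)"
      by (rule integrable_cong_AE_imp[OF square_integrable_cond_exp_given[OF fin Z Y Y2]])
         (use hE in auto)
    have g: "?g \<in> borel_measurable lam" by measurable
    have gp: "?g \<in> predictors lam Q" using g g2 by (simp add: predictors_def)
    have dec: "?risk p = (\<integral>\<omega>. (p (X_of \<omega>) - ?g (X_of \<omega>))\<^sup>2 \<partial>Q) + ?risk ?g"
      "integrable Q (\<lambda>\<omega>. (p (X_of \<omega>) - ?g (X_of \<omega>))\<^sup>2)" if "p \<in> predictors lam Q" for p
      using mean_square_error_decomposition[OF fin X Y Y2 g g2 reg, of p] that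
      by (auto simp: predictors_def)
    have "?risk ?g \<le> ?risk p" if "p \<in> predictors lam Q" for p
      using dec(1)[OF that] integral_nonneg_AE[of "\<lambda>\<omega>. (p (X_of \<omega>) - ?g (X_of \<omega>))\<^sup>2" Q] by simp
    then have bayes: "bayesian_predictor lam Q ?g"
      unfolding bayesian_predictor_def is_arg_min_linorder using gp by auto
    have p0: "p0 \<in> predictors lam Q" and "?risk p0 \<le> ?risk ?g"
      using assms(5) gp
      unfolding unique_bayesian_predictor_def bayesian_predictor_def is_arg_min_linorder by auto
    then have "(\<integral>\<omega>. (p0 (X_of \<omega>) - ?g (X_of \<omega>))\<^sup>2 \<partial>Q) \<le> 0"
      using dec(1)[OF p0] by simp
    then have "(\<integral>\<omega>. (p0 (X_of \<omega>) - ?g (X_of \<omega>))\<^sup>2 \<partial>Q) = 0"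
      by (intro antisym integral_nonneg_AE) auto
    then have "AE \<omega> in Q. (p0 (X_of \<omega>) - ?g (X_of \<omega>))\<^sup>2 = 0"
      using integral_nonneg_eq_0_iff_AE[OF dec(2)[OF p0]] by simp
    then show ?thesis using bayes by auto
  qed
  obtain h0 where h0: "h0 \<in> borel_measurable N"
    "\<And>\<omega>. \<omega> \<in> space Q \<Longrightarrow> cond_exp_given Q N ?Z Y_of \<omega> = h0 (?Z \<omega>)"
    using cond_exp_given_factorization[OF fin Z] by blast
  have "AE \<omega> in Q. h0 (?Z \<omega>) = cond_exp_given Q N ?Z Y_of \<omega>" using h0(2) by auto
  with minimal[OF h0(1) this]
  have "AE \<omega> in Q. p0 (X_of \<omega>) = cond_exp_given Q N ?Z Y_of \<omega>" by auto
  moreover have "\<forall>\<theta>\<in>\<Theta>. AE (x, y) in P \<theta>. p0 x = h (S x)"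
    if "h \<in> borel_measurable N" "AE \<omega> in Q. h (?Z \<omega>) = cond_exp_given Q N ?Z Y_of \<omega>" for h
    using minimal[OF that] assms(5) by (auto simp: unique_bayesian_predictor_def)
  ultimately show ?thesis by blast
qed

end
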